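(* Let $\left((E_i)_{i\in I},(\phi_{ij})_{i\le j\text{ in }I}\right)$ be a direct system in $\mathbf{CKGr}$ and let $(E_\infty,(\phi_{i,\infty})_{i\in I})$ be its direct limit in $\mathbf{CKGr}$. Set $\mu_{ij}=\overline{M}(\phi_{ij})$, let $\left((\overline{M}_{E_i})_{i\in I},(\mu_{ij})_{i\le j\text{ in }I}\right)$ be the associated direct system in $\mathbf{CMon}_0$, and let $(\overline{M}_\infty,(\mu_{i,\infty})_{i\in I})$ be its direct limit in $\mathbf{CMon}_0$. Then there exists a monoid isomorphism $\psi_{\overline{M}}:\overline{M}_\infty\to\overline{M}_{E_\infty}$ such that $\psi_{\overline{M}}\circ\mu_{i,\infty}=\overline{M}(\phi_{i,\infty})$ for all $i\in I$.
   Context: A (directed) graph $E=(E^0,E^1,r_E,s_E)$ consists of a set $E^0$ of vertices, a set $E^1$ of edges (arbitrary cardinality), and range and source maps $r_E,s_E:E^1\to E^0$. A vertex $v$ is a sink if $s_E^{-1}(v)=\emptyset$, an infinite emitter if $s_E^{-1}(v)$ is infinite, and regular otherwise. A CK-morphism $\eta:E\to F$ is a graph morphism (maps $\eta^0:E^0\to F^0$, $\eta^1:E^1\to F^1$ compatible with range and source) such that $\eta^0$ and $\eta^1$ are injective and, for every regular $v\in E^0$, $\eta^1$ restricts to a bijection $s_E^{-1}(v)\to s_F^{-1}(\eta^0(v))$. $\mathbf{CKGr}$ is the category of directed graphs and CK-morphisms; arbitrary direct limits (over directed index sets $I$) exist in it. $\mathbf{CMon}_0$ is the category of abelian monoids and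 identity-preserving monoid morphisms; direct limits exist in it. In a direct limit, the maps with subscript $i,\infty$ are the canonical maps from the $i$-th object. $\overline{M}_E$ is the abelian monoid generated by $\{a_v:v\in E^0\}\cup\{a_{v,S}: v \text{ an infinite emitter}, S \text{ a non-empty finite subset of } s_E^{-1}(v)\}$ subject to the relations: $a_v=\sum_{e\in s_E^{-1}(v)}a_{r_E(e)}$ for every regular vertex $v$; and, for every infinite emitter $v$ and all non-empty finite $S,T\subseteq s_E^{-1}(v)$, $a_{v,S}+\sum_{e\in S}a_{r_E(e)}=a_v$ and $a_{v,S}+\sum_{e\in S\setminus T}a_{r_E(e)}=a_{v,T}+\sum_{e\in T\setminus S}a_{r_E(e)}$. A CK-morphism $\eta:E\to F$ induces the monoid morphism $\overline{M}(\eta):\overline{M}_E\to\overline{M}_F$, $a_v\mapsto a_{\eta^0(v)}$, $a_{v,S}\mapsto a_{\eta^0(v),\eta^1(S)}$ (CK-morphisms send infinite emitters to infinite emitters and regular vertices to regular vertices). *)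

theory Defs
  imports
    "HOL-Library.Multiset"
    "HOL-Algebra.Group"
    "Graph_Theory.Digraph"
begin

section \<open>Graphs and CK-morphisms\<close>

text \<open>
  A directed graph is a \<^const>\<open>wf_digraph\<close> (loops, parallel edges and arbitrary cardinalities are
  allowed); the source map is \<^const>\<open>tail\<close>, the range map is \<^const>\<open>head\<close>, and the set of edges
  with source \<open>v\<close> is \<^term>\<open>out_arcs G v\<close>.
\<close>

definition is_sink :: "('v,'e) pre_digraph \<Rightarrow> 'v \<Rightarrow> bool" where
  "is_sink G v \<longleftrightarrow> v \<in> verts G \<and> out_arcs G v = {}"

definition infinite_emitter :: "('v,'e) pre_digraph \<Rightarrow> 'v \<Rightarrow> bool" where
  "infinite_emitter G v \<longleftrightarrow> v \<in> verts G \<and> infinite (out_arcs G v)"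

definition regular_vertex :: "('v,'e) pre_digraph \<Rightarrow> 'v \<Rightarrow> bool" where
  "regular_vertex G v \<longleftrightarrow> v \<in> verts G \<and> \<not> is_sink G v \<and> \<not> infinite_emitter G v"

text \<open>
  A morphism is represented by a pair of total functions of which only the values on vertices and
  edges of the domain matter; equality of morphisms is therefore \<open>graph_map_eq\<close>.
\<close>

type_synonym ('v,'e,'w,'f) graph_map = "('v \<Rightarrow> 'w) \<times> ('e \<Rightarrow> 'f)"

definition graph_map_eq ::
    "('v,'e) pre_digraph \<Rightarrow> ('v,'e,'w,'f) graph_map \<Rightarrow> ('v,'e,'w,'f) graph_map \<Rightarrow> bool" where
  "graph_map_eq G \<eta> \<theta> \<longleftrightarrow>
     (\<forall>v\<in>verts G. fst \<eta> v = fst \<theta> v) \<and> (\<forall>e\<in>arcs G. snd \<eta> e = snd \<theta> e)"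

definition graph_map_id :: "('v,'e,'v,'e) graph_map" where
  "graph_map_id = (id, id)"

definition graph_map_comp ::
    "('w,'f,'x,'g) graph_map \<Rightarrow> ('v,'e,'w,'f) graph_map \<Rightarrow> ('v,'e,'x,'g) graph_map" where
  "graph_map_comp \<theta> \<eta> = (fst \<theta> \<circ> fst \<eta>, snd \<theta> \<circ> snd \<eta>)"

definition graph_morphism ::
    "('v,'e) pre_digraph \<Rightarrow> ('w,'f) pre_digraph \<Rightarrow> ('v,'e,'w,'f) graph_map \<Rightarrow> bool" where
  "graph_morphism G H \<eta> \<longleftrightarrow>
     fst \<eta> ` verts G \<subseteq> verts H \<and> snd \<eta> ` arcs G \<subseteq> arcs H \<and>
     (\<forall>e\<in>arcs G. tail H (snd \<eta> e) = fst \<eta> (tail G e) \<and> head H (snd \<eta> e) = fst \<eta> (head G e))"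

definition CK_morphism ::
    "('v,'e) pre_digraph \<Rightarrow> ('w,'f) pre_digraph \<Rightarrow> ('v,'e,'w,'f) graph_map \<Rightarrow> bool" where
  "CK_morphism G H \<eta> \<longleftrightarrow>
     graph_morphism G H \<eta> \<and> inj_on (fst \<eta>) (verts G) \<and> inj_on (snd \<eta>) (arcs G) \<and>
     (\<forall>v. regular_vertex G v \<longrightarrow> bij_betw (snd \<eta>) (out_arcs G v) (out_arcs H (fst \<eta> v)))"


section \<open>Direct systems and direct limits of graphs\<close>

definition directed_index :: "'i set \<Rightarrow> 'i rel \<Rightarrow> bool" where
  "directed_index I r \<longleftrightarrow>
     I \<noteq> {} \<and> preorder_on I r \<and> (\<forall>i\<in>I. \<forall>j\<in>I. \<exists>k\<in>I. (i, k) \<in> r \<and> (j, k) \<in> r)"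

definition CKGr_direct_system ::
    "'i set \<Rightarrow> 'i rel \<Rightarrow> ('i \<Rightarrow> ('v,'e) pre_digraph) \<Rightarrow> ('i \<Rightarrow> 'i \<Rightarrow> ('v,'e,'v,'e) graph_map) \<Rightarrow> bool" where
  "CKGr_direct_system I r E \<phi> \<longleftrightarrow>
     directed_index I r \<and>
     (\<forall>i\<in>I. wf_digraph (E i)) \<and>
     (\<forall>i j. (i, j) \<in> r \<longrightarrow> CK_morphism (E i) (E j) (\<phi> i j)) \<and>
     (\<forall>i\<in>I. graph_map_eq (E i) (\<phi> i i) graph_map_id) \<and>
     (\<forall>i j k. (i, j) \<in> r \<and> (j, k) \<in> r \<longrightarrow>
        graph_map_eq (E i) (graph_map_comp (\<phi> j k) (\<phi> i j)) (\<phi> i k))"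

definition CKGr_cocone ::
    "'i set \<Rightarrow> 'i rel \<Rightarrow> ('i \<Rightarrow> ('v,'e) pre_digraph) \<Rightarrow> ('i \<Rightarrow> 'i \<Rightarrow> ('v,'e,'v,'e) graph_map) \<Rightarrow>
     ('w,'f) pre_digraph \<Rightarrow> ('i \<Rightarrow> ('v,'e,'w,'f) graph_map) \<Rightarrow> bool" where
  "CKGr_cocone I r E \<phi> L \<iota> \<longleftrightarrow>
     wf_digraph L \<and>
     (\<forall>i\<in>I. CK_morphism (E i) L (\<iota> i)) \<and>
     (\<forall>i j. (i, j) \<in> r \<longrightarrow> graph_map_eq (E i) (graph_map_comp (\<iota> j) (\<phi> i j)) (\<iota> i))"

text \<open>
  The universal property of a direct limit. Types cannot be quantified inside a formula, so the
  first argument is the type over which the competing cocones range: a direct limit in the category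
  of all graphs satisfies this predicate at every type \<open>T\<close>. Taking \<open>T\<close> to be the type of \<open>L\<close> itself
  already determines \<open>L\<close>: CK-morphisms are injective, so the limit embeds into any cocone, and the
  limit can be realised as the union in \<open>L\<close> of the images of the \<open>E i\<close>.
\<close>

definition CKGr_direct_limit ::
    "('x,'y) pre_digraph itself \<Rightarrow>
     'i set \<Rightarrow> 'i rel \<Rightarrow> ('i \<Rightarrow> ('v,'e) pre_digraph) \<Rightarrow> ('i \<Rightarrow> 'i \<Rightarrow> ('v,'e,'v,'e) graph_map) \<Rightarrow>
     ('w,'f) pre_digraph \<Rightarrow> ('i \<Rightarrow> ('v,'e,'w,'f) graph_map) \<Rightarrow> bool" where
  "CKGr_direct_limit T I r E \<phi> L \<iota> \<longleftrightarrow>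
     CKGr_cocone I r E \<phi> L \<iota> \<and>
     (\<forall>(F :: ('x,'y) pre_digraph) \<kappa>. CKGr_cocone I r E \<phi> F \<kappa> \<longrightarrow>
        (\<exists>\<eta>. CK_morphism L F \<eta> \<and>
             (\<forall>i\<in>I. graph_map_eq (E i) (graph_map_comp \<eta> (\<iota> i)) (\<kappa> i)) \<and>
             (\<forall>\<theta>. CK_morphism L F \<theta> \<and>
                  (\<forall>i\<in>I. graph_map_eq (E i) (graph_map_comp \<theta> (\<iota> i)) (\<kappa> i)) \<longrightarrow>
                  graph_map_eq L \<theta> \<eta>)))"


section \<open>Direct systems and direct limits of abelian monoids\<close>

definition CMon_hom ::
    "('a,'p) monoid_scheme \<Rightarrow> ('b,'q) monoid_scheme \<Rightarrow> ('a \<Rightarrow> 'b) \<Rightarrow> bool" where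
  "CMon_hom M N h \<longleftrightarrow> h \<in> hom M N \<and> h \<one>\<^bsub>M\<^esub> = \<one>\<^bsub>N\<^esub>"

definition CMon_direct_system ::
    "'i set \<Rightarrow> 'i rel \<Rightarrow> ('i \<Rightarrow> 'a monoid) \<Rightarrow> ('i \<Rightarrow> 'i \<Rightarrow> 'a \<Rightarrow> 'a) \<Rightarrow> bool" where
  "CMon_direct_system I r M \<mu> \<longleftrightarrow>
     directed_index I r \<and>
     (\<forall>i\<in>I. comm_monoid (M i)) \<and>
     (\<forall>i j. (i, j) \<in> r \<longrightarrow> CMon_hom (M i) (M j) (\<mu> i j)) \<and>
     (\<forall>i\<in>I. \<forall>x\<in>carrier (M i). \<mu> i i x = x) \<and>
     (\<forall>i j k. (i, j) \<in> r \<and> (j, k) \<in> r \<longrightarrow> (\<forall>x\<in>carrier (M i). \<mu> j k (\<mu> i j x) = \<mu> i k x))"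

definition CMon_cocone ::
    "'i set \<Rightarrow> 'i rel \<Rightarrow> ('i \<Rightarrow> 'a monoid) \<Rightarrow> ('i \<Rightarrow> 'i \<Rightarrow> 'a \<Rightarrow> 'a) \<Rightarrow>
     'b monoid \<Rightarrow> ('i \<Rightarrow> 'a \<Rightarrow> 'b) \<Rightarrow> bool" where
  "CMon_cocone I r M \<mu> L \<iota> \<longleftrightarrow>
     comm_monoid L \<and>
     (\<forall>i\<in>I. CMon_hom (M i) L (\<iota> i)) \<and>
     (\<forall>i j. (i, j) \<in> r \<longrightarrow> (\<forall>x\<in>carrier (M i). \<iota> j (\<mu> i j x) = \<iota> i x))"

text \<open>
  As for graphs, the first argument is the type over which the competing cocones range. A direct
  limit in the category of all abelian monoids satisfies the predicate at every type. It is
  determined up to isomorphism by the instances at its own type and at any type in which some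
  direct limit of the system can be realised; its own type alone would not suffice (consider
  the type \<^typ>\<open>unit\<close>).
\<close>

definition CMon_direct_limit ::
    "'c monoid itself \<Rightarrow>
     'i set \<Rightarrow> 'i rel \<Rightarrow> ('i \<Rightarrow> 'a monoid) \<Rightarrow> ('i \<Rightarrow> 'i \<Rightarrow> 'a \<Rightarrow> 'a) \<Rightarrow>
     'b monoid \<Rightarrow> ('i \<Rightarrow> 'a \<Rightarrow> 'b) \<Rightarrow> bool" where
  "CMon_direct_limit T I r M \<mu> L \<iota> \<longleftrightarrow>
     CMon_cocone I r M \<mu> L \<iota> \<and>
     (\<forall>(N :: 'c monoid) \<kappa>. CMon_cocone I r M \<mu> N \<kappa> \<longrightarrow>
        (\<exists>h. CMon_hom L N h \<and>
             (\<forall>i\<in>I. \<forall>x\<in>carrier (M i). h (\<iota> i x) = \<kappa> i x) \<and>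
             (\<forall>g. CMon_hom L N g \<and> (\<forall>i\<in>I. \<forall>x\<in>carrier (M i). g (\<iota> i x) = \<kappa> i x) \<longrightarrow>
                  (\<forall>y\<in>carrier L. g y = h y))))"


section \<open>Presentations of abelian monoids\<close>

text \<open>
  The free abelian monoid on \<open>X\<close> consists of the finite multisets over \<open>X\<close>; \<open>cmon_cong X R\<close> is the
  congruence on it generated by the relations \<open>R\<close>, and \<open>presented_cmon X R\<close> is the quotient.
\<close>

inductive_set cmon_cong ::
    "'g set \<Rightarrow> ('g multiset \<times> 'g multiset) set \<Rightarrow> ('g multiset \<times> 'g multiset) set"
  for X :: "'g set" and R :: "('g multiset \<times> 'g multiset) set" where
  rel: "(a, b) \<in> R \<Longrightarrow> (a, b) \<in> cmon_cong X R"
| refl: "set_mset a \<subseteq> X \<Longrightarrow> (a, a) \<in> cmon_cong X R"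
| sym: "(a, b) \<in> cmon_cong X R \<Longrightarrow> (b, a) \<in> cmon_cong X R"
| trans: "(a, b) \<in> cmon_cong X R \<Longrightarrow> (b, c) \<in> cmon_cong X R \<Longrightarrow> (a, c) \<in> cmon_cong X R"
| add: "(a, b) \<in> cmon_cong X R \<Longrightarrow> (c, d) \<in> cmon_cong X R \<Longrightarrow> (a + c, b + d) \<in> cmon_cong X R"

definition cmon_class :: "'g set \<Rightarrow> ('g multiset \<times> 'g multiset) set \<Rightarrow> 'g multiset \<Rightarrow> 'g multiset set" where
  "cmon_class X R a = cmon_cong X R `` {a}"

definition presented_cmon ::
    "'g set \<Rightarrow> ('g multiset \<times> 'g multiset) set \<Rightarrow> 'g multiset set monoid" where
  "presented_cmon X R =
     \<lparr>carrier = {a. set_mset a \<subseteq> X} // cmon_cong X R,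
      mult = (\<lambda>A B. \<Union>a\<in>A. \<Union>b\<in>B. cmon_class X R (a + b)),
      one = cmon_class X R {#}\<rparr>"


section \<open>The monoid of a graph and the induced morphisms\<close>

text \<open>\<open>Gen v\<close> stands for the generator $a_v$ and \<open>GenInf v S\<close> for $a_{v,S}$.\<close>

datatype ('v,'e) Mbar_gen = Gen 'v | GenInf 'v "'e set"

type_synonym ('v,'e) Mbar_elt = "('v,'e) Mbar_gen multiset set"

definition emission_sets :: "('v,'e) pre_digraph \<Rightarrow> 'v \<Rightarrow> 'e set set" where
  "emission_sets G v = {S. S \<noteq> {} \<and> finite S \<and> S \<subseteq> out_arcs G v}"

definition Mbar_gens :: "('v,'e) pre_digraph \<Rightarrow> ('v,'e) Mbar_gen set" where
  "Mbar_gens G =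
     {Gen v |v. v \<in> verts G} \<union> {GenInf v S |v S. infinite_emitter G v \<and> S \<in> emission_sets G v}"

definition range_sum :: "('v,'e) pre_digraph \<Rightarrow> 'e set \<Rightarrow> ('v,'e) Mbar_gen multiset" where
  "range_sum G S = (\<Sum>e\<in>S. {#Gen (head G e)#})"

definition Mbar_rels ::
    "('v,'e) pre_digraph \<Rightarrow> (('v,'e) Mbar_gen multiset \<times> ('v,'e) Mbar_gen multiset) set" where
  "Mbar_rels G =
     {({#Gen v#}, range_sum G (out_arcs G v)) |v. regular_vertex G v} \<union>
     {({#GenInf v S#} + range_sum G S, {#Gen v#}) |v S.
        infinite_emitter G v \<and> S \<in> emission_sets G v} \<union>
     {({#GenInf v S#} + range_sum G (S - T), {#GenInf v T#} + range_sum G (T - S)) |v S T.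
        infinite_emitter G v \<and> S \<in> emission_sets G v \<and> T \<in> emission_sets G v}"

definition Mbar :: "('v,'e) pre_digraph \<Rightarrow> ('v,'e) Mbar_elt monoid" where
  "Mbar G = presented_cmon (Mbar_gens G) (Mbar_rels G)"

definition Mbar_class :: "('v,'e) pre_digraph \<Rightarrow> ('v,'e) Mbar_gen multiset \<Rightarrow> ('v,'e) Mbar_elt" where
  "Mbar_class G = cmon_class (Mbar_gens G) (Mbar_rels G)"

primrec Mbar_gen_map :: "('v,'e,'w,'f) graph_map \<Rightarrow> ('v,'e) Mbar_gen \<Rightarrow> ('w,'f) Mbar_gen" where
  "Mbar_gen_map \<eta> (Gen v) = Gen (fst \<eta> v)"
| "Mbar_gen_map \<eta> (GenInf v S) = GenInf (fst \<eta> v) (snd \<eta> ` S)"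

text \<open>
  \<open>Mbar_map H \<eta>\<close> is the morphism induced by a CK-morphism \<open>\<eta>\<close> from \<open>G\<close> to \<open>H\<close>. It sends the class of
  a word to the class of its image; all members of a class have equivalent images
  (\<open>Mbar_map_class\<close> below), so the union is over copies of one class.
\<close>

definition Mbar_map ::
    "('w,'f) pre_digraph \<Rightarrow> ('v,'e,'w,'f) graph_map \<Rightarrow> ('v,'e) Mbar_elt \<Rightarrow> ('w,'f) Mbar_elt" where
  "Mbar_map H \<eta> A = (\<Union>a\<in>A. Mbar_class H (image_mset (Mbar_gen_map \<eta>) a))"


subsection \<open>Well-definedness\<close>

lemma cmon_cong_words:
  assumes "\<And>a b. (a, b) \<in> R \<Longrightarrow> set_mset a \<subseteq> X \<and> set_mset b \<subseteq> X" "(a, b) \<in> cmon_cong X R"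
  shows "set_mset a \<subseteq> X \<and> set_mset b \<subseteq> X"
  using assms(2) by (induction rule: cmon_cong.induct) (auto dest: assms(1))

lemma cmon_class_eq_iff:
  assumes "set_mset b \<subseteq> X"
  shows "cmon_class X R a = cmon_class X R b \<longleftrightarrow> (a, b) \<in> cmon_cong X R"
proof
  assume "cmon_class X R a = cmon_class X R b"
  moreover have "b \<in> cmon_class X R b"
    using assms by (simp add: cmon_class_def cmon_cong.refl)
  ultimately show "(a, b) \<in> cmon_cong X R"
    by (auto simp: cmon_class_def)
next
  assume "(a, b) \<in> cmon_cong X R"
  then show "cmon_class X R a = cmon_class X R b"
    unfolding cmon_class_def by (blast intro: cmon_cong.sym cmon_cong.trans)
qed

lemma presented_cmon_carrier:
  "carrier (presented_cmon X R) = cmon_class X R ` {a. set_mset a \<subseteq> X}"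
  by (auto simp: presented_cmon_def cmon_class_def quotient_def)

lemma presented_cmon_mult:
  assumes "set_mset a \<subseteq> X" "set_mset b \<subseteq> X"
  shows "cmon_class X R a \<otimes>\<^bsub>presented_cmon X R\<^esub> cmon_class X R b = cmon_class X R (a + b)"
proof -
  have "a \<in> cmon_class X R a" "b \<in> cmon_class X R b"
    using assms by (auto simp: cmon_class_def intro: cmon_cong.refl)
  moreover have "cmon_class X R (a' + b') = cmon_class X R (a + b)"
    if "a' \<in> cmon_class X R a" "b' \<in> cmon_class X R b" for a' b'
    using that assms
    by (subst cmon_class_eq_iff) (auto simp: cmon_class_def intro: cmon_cong.add cmon_cong.sym)
  ultimately have "(\<Union>a'\<in>cmon_class X R a. \<Union>b'\<in>cmon_class X R b. cmon_class X R (a' + b'))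
      = cmon_class X R (a + b)"
    by blast
  then show ?thesis by (simp add: presented_cmon_def)
qed

lemma presented_cmon_one: "\<one>\<^bsub>presented_cmon X R\<^esub> = cmon_class X R {#}"
  by (simp add: presented_cmon_def)

lemma comm_monoid_presented_cmon: "comm_monoid (presented_cmon X R)"
proof (rule comm_monoidI)
  fix x y z
  assume "x \<in> carrier (presented_cmon X R)" "y \<in> carrier (presented_cmon X R)"
    "z \<in> carrier (presented_cmon X R)"
  then show "x \<otimes>\<^bsub>presented_cmon X R\<^esub> y \<otimes>\<^bsub>presented_cmon X R\<^esub> z
      = x \<otimes>\<^bsub>presented_cmon X R\<^esub> (y \<otimes>\<^bsub>presented_cmon X R\<^esub> z)"
    by (auto simp: presented_cmon_carrier presented_cmon_mult add.assoc)
qed (auto simp: presented_cmon_carrier presented_cmon_mult presented_cmon_one add.commute)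

lemma range_sum_eq: "finite S \<Longrightarrow> range_sum G S = image_mset (\<lambda>e. Gen (head G e)) (mset_set S)"
  unfolding range_sum_def by (induction rule: finite_induct) auto

lemma regular_vertex_iff:
  "regular_vertex G v \<longleftrightarrow> v \<in> verts G \<and> finite (out_arcs G v) \<and> out_arcs G v \<noteq> {}"
  by (auto simp: regular_vertex_def is_sink_def infinite_emitter_def)

lemma range_sum_gens:
  assumes "wf_digraph G" "finite S" "S \<subseteq> arcs G"
  shows "set_mset (range_sum G S) \<subseteq> Mbar_gens G"
proof -
  have "head G e \<in> verts G" if "e \<in> S" for e
    using that assms(3) wf_digraph.head_in_verts[OF assms(1)] by blast
  then show ?thesis
    using assms(2) by (auto simp: range_sum_eq Mbar_gens_def)
qed

lemma out_arcs_subset: "out_arcs G v \<subseteq> arcs G"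
  by (auto simp: out_arcs_def)

lemma Mbar_relsE:
  assumes "(a, b) \<in> Mbar_rels G"
  obtains
    (regular) v where "regular_vertex G v" "a = {#Gen v#}" "b = range_sum G (out_arcs G v)"
  | (vertex) v S where "infinite_emitter G v" "S \<in> emission_sets G v"
      "a = {#GenInf v S#} + range_sum G S" "b = {#Gen v#}"
  | (swap) v S T where "infinite_emitter G v" "S \<in> emission_sets G v" "T \<in> emission_sets G v"
      "a = {#GenInf v S#} + range_sum G (S - T)" "b = {#GenInf v T#} + range_sum G (T - S)"
proof -
  from assms consider
      "\<exists>v. (a, b) = ({#Gen v#}, range_sum G (out_arcs G v)) \<and> regular_vertex G v"
    | "\<exists>v S. (a, b) = ({#GenInf v S#} + range_sum G S, {#Gen v#}) \<and>
        infinite_emitter G v \<and> S \<in> emission_sets G v"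
    | "\<exists>v S T. (a, b) = ({#GenInf v S#} + range_sum G (S - T), {#GenInf v T#} + range_sum G (T - S)) \<and>
        infinite_emitter G v \<and> S \<in> emission_sets G v \<and> T \<in> emission_sets G v"
    unfolding Mbar_rels_def Un_iff mem_Collect_eq by argo
  then show thesis
    by cases (use regular vertex swap in \<open>elim exE conjE; simp only: prod.inject\<close>)+
qed

lemma Mbar_rels_words:
  assumes "wf_digraph G" "(a, b) \<in> Mbar_rels G"
  shows "set_mset a \<subseteq> Mbar_gens G \<and> set_mset b \<subseteq> Mbar_gens G"
proof -
  have r: "set_mset (range_sum G S) \<subseteq> Mbar_gens G" if "finite S" "S \<subseteq> out_arcs G v" for S v
    by (rule range_sum_gens[OF assms(1) that(1) order.trans[OF that(2) out_arcs_subset]])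
  have d: "set_mset (range_sum G (S - T)) \<subseteq> Mbar_gens G" if "S \<in> emission_sets G v" for S T v
    using that by (intro r[of _ v]) (auto simp: emission_sets_def)
  from assms(2) show ?thesis
  proof (cases rule: Mbar_relsE)
    case (regular v)
    then show ?thesis
      using r[of "out_arcs G v" v] by (simp add: regular_vertex_iff) (simp add: Mbar_gens_def)
  next
    case (vertex v S)
    then show ?thesis
      using d[of S v "{}"] by (simp add: infinite_emitter_def) (simp add: Mbar_gens_def infinite_emitter_def)
  next
    case (swap v S T)
    then show ?thesis
      using d[of S v T] d[of T v S] by simp (simp add: Mbar_gens_def)
  qed
qed

lemma CK_out_arcs:
  assumes "CK_morphism G H \<eta>"
  shows "snd \<eta> ` out_arcs G v \<subseteq> out_arcs H (fst \<eta> v)"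
  using assms by (auto simp: CK_morphism_def graph_morphism_def out_arcs_def)

lemma CK_regular:
  assumes "CK_morphism G H \<eta>" "regular_vertex G v"
  shows "regular_vertex H (fst \<eta> v)" "snd \<eta> ` out_arcs G v = out_arcs H (fst \<eta> v)"
proof -
  show *: "snd \<eta> ` out_arcs G v = out_arcs H (fst \<eta> v)"
    using assms by (auto simp: CK_morphism_def bij_betw_def)
  show "regular_vertex H (fst \<eta> v)"
    using assms unfolding regular_vertex_iff *[symmetric]
    by (auto simp: CK_morphism_def graph_morphism_def)
qed

lemma CK_infinite_emitter:
  assumes "CK_morphism G H \<eta>" "infinite_emitter G v"
  shows "infinite_emitter H (fst \<eta> v)"
proof -
  have "inj_on (snd \<eta>) (out_arcs G v)"
    using assms(1) inj_on_subset[OF _ out_arcs_subset] by (auto simp: CK_morphism_def)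
  then have "infinite (snd \<eta> ` out_arcs G v)"
    using assms(2) by (simp add: finite_image_iff infinite_emitter_def)
  then show ?thesis
    using assms CK_out_arcs[OF assms(1), of v] finite_subset
    by (auto simp: infinite_emitter_def CK_morphism_def graph_morphism_def)
qed

lemma CK_emission_sets:
  assumes "CK_morphism G H \<eta>" "S \<in> emission_sets G v"
  shows "snd \<eta> ` S \<in> emission_sets H (fst \<eta> v)"
  using assms CK_out_arcs[OF assms(1), of v] by (auto simp: emission_sets_def)

lemma CK_gens:
  assumes "CK_morphism G H \<eta>" "set_mset a \<subseteq> Mbar_gens G"
  shows "set_mset (image_mset (Mbar_gen_map \<eta>) a) \<subseteq> Mbar_gens H"
proof -
  have "Mbar_gen_map \<eta> x \<in> Mbar_gens H" if "x \<in> Mbar_gens G" for x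
    using that assms(1) CK_infinite_emitter[OF assms(1)] CK_emission_sets[OF assms(1)]
    by (auto simp: Mbar_gens_def CK_morphism_def graph_morphism_def)
  then show ?thesis using assms(2) by auto
qed

lemma CK_range_sum:
  assumes "CK_morphism G H \<eta>" "finite S" "S \<subseteq> arcs G"
  shows "image_mset (Mbar_gen_map \<eta>) (range_sum G S) = range_sum H (snd \<eta> ` S)"
proof -
  have inj: "inj_on (snd \<eta>) S"
    using assms inj_on_subset by (auto simp: CK_morphism_def)
  have "range_sum H (snd \<eta> ` S) = image_mset (\<lambda>e. Gen (head H (snd \<eta> e))) (mset_set S)"
    using assms(2) by (simp add: range_sum_eq image_mset_mset_set[OF inj, symmetric]
        image_mset.compositionality comp_def)
  also have "\<dots> = image_mset (\<lambda>e. Gen (fst \<eta> (head G e))) (mset_set S)"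
    using assms by (intro image_mset_cong) (auto simp: CK_morphism_def graph_morphism_def)
  finally show ?thesis
    using assms(2) by (simp add: range_sum_eq image_mset.compositionality comp_def)
qed

lemma CK_rels:
  assumes "CK_morphism G H \<eta>" "(a, b) \<in> Mbar_rels G"
  shows "(image_mset (Mbar_gen_map \<eta>) a, image_mset (Mbar_gen_map \<eta>) b) \<in> Mbar_rels H"
proof -
  have diff: "snd \<eta> ` (S - T) = snd \<eta> ` S - snd \<eta> ` T" if "S \<in> emission_sets G v" "T \<in> emission_sets G v"
    for S T v
  proof (rule inj_on_image_set_diff)
    show "inj_on (snd \<eta>) (arcs G)" using assms(1) by (simp add: CK_morphism_def)
    show "S - T \<subseteq> arcs G" "T \<subseteq> arcs G"
      using that out_arcs_subset by (auto simp: emission_sets_def dest!: subsetD)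
  qed
  have sub: "finite S" "S \<subseteq> arcs G" if "S \<in> emission_sets G v" for S v
    using that out_arcs_subset by (auto simp: emission_sets_def dest!: subsetD)
  from assms(2) show ?thesis
  proof (cases rule: Mbar_relsE)
    case (regular v)
    then have "image_mset (Mbar_gen_map \<eta>) b = range_sum H (out_arcs H (fst \<eta> v))"
      using CK_range_sum[OF assms(1) _ out_arcs_subset] CK_regular[OF assms(1)]
      by (simp add: regular_vertex_iff)
    then show ?thesis
      using regular CK_regular[OF assms(1), of v] by (auto simp: Mbar_rels_def)
  next
    case (vertex v S)
    then show ?thesis
      using CK_range_sum[OF assms(1) sub, OF vertex(2) vertex(2)] CK_infinite_emitter[OF assms(1) vertex(1)]
        CK_emission_sets[OF assms(1) vertex(2)]
      unfolding Mbar_rels_def by (intro UnI1 UnI2) auto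
  next
    case (swap v S T)
    have "image_mset (Mbar_gen_map \<eta>) (range_sum G (S - T)) = range_sum H (snd \<eta> ` S - snd \<eta> ` T)"
      "image_mset (Mbar_gen_map \<eta>) (range_sum G (T - S)) = range_sum H (snd \<eta> ` T - snd \<eta> ` S)"
      using CK_range_sum[OF assms(1)] sub[OF swap(2)] sub[OF swap(3)] diff[OF swap(2,3)] diff[OF swap(3,2)]
      by (metis Diff_subset finite_Diff subset_trans)+
    then show ?thesis
      using swap CK_infinite_emitter[OF assms(1) swap(1)] CK_emission_sets[OF assms(1) swap(2)]
        CK_emission_sets[OF assms(1) swap(3)]
      unfolding Mbar_rels_def by (intro UnI2) auto
  qed
qed

lemma CK_cong:
  assumes "CK_morphism G H \<eta>" "(a, b) \<in> cmon_cong (Mbar_gens G) (Mbar_rels G)"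
  shows "(image_mset (Mbar_gen_map \<eta>) a, image_mset (Mbar_gen_map \<eta>) b)
    \<in> cmon_cong (Mbar_gens H) (Mbar_rels H)"
  using assms(2)
proof (induction rule: cmon_cong.induct)
  case (rel a b)
  then show ?case using CK_rels[OF assms(1)] by (blast intro: cmon_cong.rel)
next
  case (refl a)
  then show ?case using CK_gens[OF assms(1)] by (blast intro: cmon_cong.refl)
next
  case (add a b c d)
  then show ?case by (simp add: cmon_cong.add)
qed (blast intro: cmon_cong.sym cmon_cong.trans)+

lemma Mbar_map_class:
  assumes "CK_morphism G H \<eta>" "set_mset a \<subseteq> Mbar_gens G"
  shows "Mbar_map H \<eta> (Mbar_class G a) = Mbar_class H (image_mset (Mbar_gen_map \<eta>) a)"
proof -
  have "a \<in> Mbar_class G a"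
    using assms(2) by (auto simp: Mbar_class_def cmon_class_def intro: cmon_cong.refl)
  moreover have "Mbar_class H (image_mset (Mbar_gen_map \<eta>) b) = Mbar_class H (image_mset (Mbar_gen_map \<eta>) a)"
    if "b \<in> Mbar_class G a" for b
    using that CK_cong[OF assms(1), of b a] CK_gens[OF assms]
    unfolding Mbar_class_def
    by (subst cmon_class_eq_iff) (auto simp: cmon_class_def intro: cmon_cong.sym)
  ultimately show ?thesis unfolding Mbar_map_def by blast
qed

lemma comm_monoid_Mbar: "comm_monoid (Mbar G)"
  by (simp add: Mbar_def comm_monoid_presented_cmon)

lemma Mbar_carrier: "carrier (Mbar G) = Mbar_class G ` {a. set_mset a \<subseteq> Mbar_gens G}"
  by (simp add: Mbar_def Mbar_class_def presented_cmon_carrier)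

lemma Mbar_mult:
  assumes "set_mset a \<subseteq> Mbar_gens G" "set_mset b \<subseteq> Mbar_gens G"
  shows "Mbar_class G a \<otimes>\<^bsub>Mbar G\<^esub> Mbar_class G b = Mbar_class G (a + b)"
  using assms by (simp add: Mbar_def Mbar_class_def presented_cmon_mult)

lemma Mbar_one: "\<one>\<^bsub>Mbar G\<^esub> = Mbar_class G {#}"
  by (simp add: Mbar_def Mbar_class_def presented_cmon_one)

lemma CMon_hom_Mbar_map:
  assumes "CK_morphism G H \<eta>"
  shows "CMon_hom (Mbar G) (Mbar H) (Mbar_map H \<eta>)"
  unfolding CMon_hom_def
proof (intro conjI homI)
  fix x y assume "x \<in> carrier (Mbar G)" "y \<in> carrier (Mbar G)"
  then show "Mbar_map H \<eta> (x \<otimes>\<^bsub>Mbar G\<^esub> y) = Mbar_map H \<eta> x \<otimes>\<^bsub>Mbar H\<^esub> Mbar_map H \<eta> y"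
    using CK_gens[OF assms] by (auto simp: Mbar_carrier Mbar_mult Mbar_map_class[OF assms])
next
  fix x assume "x \<in> carrier (Mbar G)"
  then show "Mbar_map H \<eta> x \<in> carrier (Mbar H)"
    using CK_gens[OF assms] by (auto simp: Mbar_carrier Mbar_map_class[OF assms])
next
  show "Mbar_map H \<eta> \<one>\<^bsub>Mbar G\<^esub> = \<one>\<^bsub>Mbar H\<^esub>"
    by (simp add: Mbar_one Mbar_map_class[OF assms])
qed

lemma Mbar_gen_map_cong:
  assumes "graph_map_eq G \<eta> \<theta>" "x \<in> Mbar_gens G"
  shows "Mbar_gen_map \<eta> x = Mbar_gen_map \<theta> x"
proof -
  have "snd \<eta> ` S = snd \<theta> ` S" if "S \<in> emission_sets G v" for v S
    using that assms(1) by (intro image_cong) (auto simp: graph_map_eq_def emission_sets_def out_arcs_def)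
  then show ?thesis
    using assms by (auto simp: Mbar_gens_def graph_map_eq_def infinite_emitter_def)
qed

lemma Mbar_gen_map_id: "Mbar_gen_map graph_map_id x = x"
  by (cases x) (auto simp: graph_map_id_def)

lemma Mbar_gen_map_comp: "Mbar_gen_map (graph_map_comp \<theta> \<eta>) x = Mbar_gen_map \<theta> (Mbar_gen_map \<eta> x)"
  by (cases x) (auto simp: graph_map_comp_def image_comp)

text \<open>The functor takes a direct system of graphs to a direct system of abelian monoids.\<close>

lemma CMon_direct_system_Mbar:
  assumes "CKGr_direct_system I r E \<phi>"
  shows "CMon_direct_system I r (\<lambda>i. Mbar (E i)) (\<lambda>i j. Mbar_map (E j) (\<phi> i j))"
proof -
  have r: "r \<subseteq> I \<times> I" "\<And>i. i \<in> I \<Longrightarrow> (i, i) \<in> r" "trans r"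
    using assms by (auto simp: CKGr_direct_system_def directed_index_def preorder_on_def refl_on_def)
  have ck: "CK_morphism (E i) (E j) (\<phi> i j)" if "(i, j) \<in> r" for i j
    using assms that by (auto simp: CKGr_direct_system_def)
  have id: "Mbar_map (E i) (\<phi> i i) x = x" if i: "i \<in> I" and x: "x \<in> carrier (Mbar (E i))" for i x
  proof -
    obtain a where a: "x = Mbar_class (E i) a" "set_mset a \<subseteq> Mbar_gens (E i)"
      using x by (auto simp: Mbar_carrier)
    have "graph_map_eq (E i) (\<phi> i i) graph_map_id"
      using assms i by (simp add: CKGr_direct_system_def)
    then have "image_mset (Mbar_gen_map (\<phi> i i)) a = image_mset (\<lambda>y. y) a"
      using a(2) by (intro image_mset_cong) (auto simp: Mbar_gen_map_id dest!: Mbar_gen_map_cong)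
    then show ?thesis
      using Mbar_map_class[OF ck[OF r(2)[OF i]] a(2)] a(1) by simp
  qed
  have comp: "Mbar_map (E k) (\<phi> j k) (Mbar_map (E j) (\<phi> i j) x) = Mbar_map (E k) (\<phi> i k) x"
    if ij: "(i, j) \<in> r" and jk: "(j, k) \<in> r" and x: "x \<in> carrier (Mbar (E i))" for i j k x
  proof -
    obtain a where a: "x = Mbar_class (E i) a" "set_mset a \<subseteq> Mbar_gens (E i)"
      using x by (auto simp: Mbar_carrier)
    have ik: "(i, k) \<in> r" using r(3) ij jk by (meson transD)
    have "graph_map_eq (E i) (graph_map_comp (\<phi> j k) (\<phi> i j)) (\<phi> i k)"
      using assms ij jk unfolding CKGr_direct_system_def by blast
    then have "image_mset (\<lambda>y. Mbar_gen_map (\<phi> j k) (Mbar_gen_map (\<phi> i j) y)) a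
        = image_mset (Mbar_gen_map (\<phi> i k)) a"
      using a(2) by (intro image_mset_cong)
        (auto simp: Mbar_gen_map_comp[symmetric] intro!: Mbar_gen_map_cong)
    then show ?thesis
      using a CK_gens[OF ck[OF ij] a(2)]
      by (simp add: Mbar_map_class[OF ck[OF ij]] Mbar_map_class[OF ck[OF jk]]
          Mbar_map_class[OF ck[OF ik]] image_mset.compositionality comp_def)
  qed
  show ?thesis
    unfolding CMon_direct_system_def
    using assms comm_monoid_Mbar CMon_hom_Mbar_map[OF ck] id comp
    by (auto simp: CKGr_direct_system_def)
qed

end

theory Submission
  imports Defs
begin

text \<open>
  A direct limit of graphs is covered by the images of the \<open>E i\<close>: the union of the images is a
  subgraph whose inclusion into the limit is again a CK-morphism, so it contains the limit by the
  universal property. Since the CK-morphisms into the limit are injective, every word and every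
  defining relation of the monoid of the limit is therefore the image of a word, unique up to
  passing to a later index, or of a relation over some \<open>E i\<close>. Hence the monoid of the limit has the
  universal property of the direct limit of the monoids.
\<close>

section \<open>Directed index sets\<close>

text \<open>Induction on the finite set: nonemptiness of \<open>I\<close> starts it, and each
  further element costs one common upper bound. This puts the finitely many ingredients of a word or
  a relation over a single index.\<close>

lemma directed_finite_subset:
  assumes dir: "directed_index I r"
    and mono: "\<forall>(i, j)\<in>r. X i \<subseteq> X j"
    and S: "finite S" "S \<subseteq> (\<Union>i\<in>I. X i)"
  obtains i where "i \<in> I" "S \<subseteq> X i"
proof -
  have "\<exists>i\<in>I. S \<subseteq> X i"
    using S
  proof (induction rule: finite_induct)
    case empty
    then show ?case using dir by (auto simp: directed_index_def)
  next
    case (insert x S)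
    then obtain i j where ij: "i \<in> I" "S \<subseteq> X i" "j \<in> I" "x \<in> X j"
      by auto
    then obtain k where "k \<in> I" "(i, k) \<in> r" "(j, k) \<in> r"
      using dir unfolding directed_index_def by blast
    with ij mono show ?case by blast
  qed
  with that show thesis by blast
qed

section \<open>Uniqueness of direct limits of abelian monoids\<close>

lemma CMon_hom_id: "CMon_hom M M (\<lambda>x. x)"
  by (simp add: CMon_hom_def hom_def)

lemma CMon_hom_comp: "CMon_hom M N f \<Longrightarrow> CMon_hom N P g \<Longrightarrow> CMon_hom M P (\<lambda>x. g (f x))"
  by (auto simp: CMon_hom_def hom_def Pi_iff)

lemma CMon_hom_carrier: "CMon_hom M N f \<Longrightarrow> x \<in> carrier M \<Longrightarrow> f x \<in> carrier N"
  by (auto simp: CMon_hom_def hom_def)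

lemma CMon_direct_limit_cocone: "CMon_direct_limit T I r M \<mu> L \<iota> \<Longrightarrow> CMon_cocone I r M \<mu> L \<iota>"
  by (simp add: CMon_direct_limit_def)

lemma CMon_direct_limit_factor:
  fixes N :: "'c monoid"
  assumes "CMon_direct_limit TYPE('c monoid) I r M \<mu> L \<iota>" "CMon_cocone I r M \<mu> N \<kappa>"
  obtains h where "CMon_hom L N h" "\<And>i x. i \<in> I \<Longrightarrow> x \<in> carrier (M i) \<Longrightarrow> h (\<iota> i x) = \<kappa> i x"
  using assms unfolding CMon_direct_limit_def by blast

text \<open>Both \<open>g\<close> and the identity factor the cocone \<open>\<iota>\<close> through
  itself, so uniqueness makes them agree. The competing cocone is \<open>L\<close>, hence the
  instance of the universal property at the type of \<open>L\<close>.\<close>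

lemma CMon_direct_limit_endo:
  fixes L :: "'b monoid"
  assumes lim: "CMon_direct_limit TYPE('b monoid) I r M \<mu> L \<iota>"
    and g: "CMon_hom L L g" "\<And>i x. i \<in> I \<Longrightarrow> x \<in> carrier (M i) \<Longrightarrow> g (\<iota> i x) = \<iota> i x"
    and y: "y \<in> carrier L"
  shows "g y = y"
proof -
  obtain h where h: "\<forall>g. CMon_hom L L g \<and> (\<forall>i\<in>I. \<forall>x\<in>carrier (M i). g (\<iota> i x) = \<iota> i x) \<longrightarrow>
      (\<forall>y\<in>carrier L. g y = h y)"
    using lim unfolding CMon_direct_limit_def by blast
  have "g y = h y"
    using h g y by blast
  moreover have "y = h y"
    using h[rule_format, of "\<lambda>x. x"] CMon_hom_id y by blast
  ultimately show ?thesis by simp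
qed

text \<open>The usual back-and-forth argument. Each limit is taken at two types: at the type of the
  other one to obtain the comparison map, and at its own type to see that the round trip is the
  identity.\<close>

lemma CMon_direct_limit_unique:
  fixes L :: "'b monoid" and L' :: "'c monoid"
  assumes L: "CMon_direct_limit TYPE('b monoid) I r M \<mu> L \<iota>"
      "CMon_direct_limit TYPE('c monoid) I r M \<mu> L \<iota>"
    and L': "CMon_direct_limit TYPE('b monoid) I r M \<mu> L' \<iota>'"
      "CMon_direct_limit TYPE('c monoid) I r M \<mu> L' \<iota>'"
  shows "\<exists>\<psi>. CMon_hom L L' \<psi> \<and> bij_betw \<psi> (carrier L) (carrier L') \<and>
    (\<forall>i\<in>I. \<forall>x\<in>carrier (M i). \<psi> (\<iota> i x) = \<iota>' i x)"
proof -
  obtain f where f: "CMon_hom L L' f"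
      "\<And>i x. i \<in> I \<Longrightarrow> x \<in> carrier (M i) \<Longrightarrow> f (\<iota> i x) = \<iota>' i x"
    using CMon_direct_limit_factor[OF L(2) CMon_direct_limit_cocone[OF L'(1)]] by blast
  obtain g where g: "CMon_hom L' L g"
      "\<And>i x. i \<in> I \<Longrightarrow> x \<in> carrier (M i) \<Longrightarrow> g (\<iota>' i x) = \<iota> i x"
    using CMon_direct_limit_factor[OF L'(1) CMon_direct_limit_cocone[OF L(1)]] by blast
  have "g (f y) = y" if "y \<in> carrier L" for y
    by (rule CMon_direct_limit_endo[OF L(1) CMon_hom_comp[OF f(1) g(1)]]) (simp_all add: f g that)
  moreover have "f (g y) = y" if "y \<in> carrier L'" for y
    by (rule CMon_direct_limit_endo[OF L'(2) CMon_hom_comp[OF g(1) f(1)]]) (simp_all add: f g that)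
  ultimately have "bij_betw f (carrier L) (carrier L')"
    using f(1) g(1) by (intro bij_betw_byWitness[where f' = g]) (auto intro: CMon_hom_carrier)
  with f show ?thesis by blast
qed

section \<open>Direct limits of graphs are covered by the images\<close>

lemma CKGr_cocone_CK: "CKGr_cocone I r E \<phi> L \<iota> \<Longrightarrow> i \<in> I \<Longrightarrow> CK_morphism (E i) L (\<iota> i)"
  by (simp add: CKGr_cocone_def)

text \<open>The union of the images, with the total functions \<open>tail L\<close> and
  \<open>head L\<close> kept as they are; edges leaving a vertex here and in \<open>L\<close> can
  then be compared as sets, and the maps \<open>\<iota> i\<close> land in it unchanged.\<close>

definition cocone_image ::
    "'i set \<Rightarrow> ('i \<Rightarrow> ('v,'e) pre_digraph) \<Rightarrow> ('w,'f) pre_digraph \<Rightarrow>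
     ('i \<Rightarrow> ('v,'e,'w,'f) graph_map) \<Rightarrow> ('w,'f) pre_digraph" where
  "cocone_image I E L \<iota> =
     \<lparr>verts = (\<Union>i\<in>I. fst (\<iota> i) ` verts (E i)), arcs = (\<Union>i\<in>I. snd (\<iota> i) ` arcs (E i)),
      tail = tail L, head = head L\<rparr>"

lemma cocone_image_simps [simp]:
  "verts (cocone_image I E L \<iota>) = (\<Union>i\<in>I. fst (\<iota> i) ` verts (E i))"
  "arcs (cocone_image I E L \<iota>) = (\<Union>i\<in>I. snd (\<iota> i) ` arcs (E i))"
  "tail (cocone_image I E L \<iota>) = tail L"
  "head (cocone_image I E L \<iota>) = head L"
  by (simp_all add: cocone_image_def)

lemma CK_arcs:
  assumes "CK_morphism G H \<eta>" "e \<in> arcs G"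
  shows "snd \<eta> e \<in> arcs H" "tail H (snd \<eta> e) = fst \<eta> (tail G e)" "head H (snd \<eta> e) = fst \<eta> (head G e)"
  using assms by (auto simp: CK_morphism_def graph_morphism_def)

lemma CK_verts: "CK_morphism G H \<eta> \<Longrightarrow> v \<in> verts G \<Longrightarrow> fst \<eta> v \<in> verts H"
  by (auto simp: CK_morphism_def graph_morphism_def)

lemma CK_inj: "CK_morphism G H \<eta> \<Longrightarrow> inj_on (fst \<eta>) (verts G) \<and> inj_on (snd \<eta>) (arcs G)"
  by (simp add: CK_morphism_def)

section \<open>The union of the images as a subgraph of the limit\<close>

context
  fixes I :: "'i set" and r :: "'i rel"
    and E :: "'i \<Rightarrow> ('v,'e) pre_digraph" and \<phi> :: "'i \<Rightarrow> 'i \<Rightarrow> ('v,'e,'v,'e) graph_map"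
    and L :: "('w,'f) pre_digraph" and \<iota> :: "'i \<Rightarrow> ('v,'e,'w,'f) graph_map"
  assumes sys: "CKGr_direct_system I r E \<phi>"
    and coc: "CKGr_cocone I r E \<phi> L \<iota>"
begin

private abbreviation "U \<equiv> cocone_image I E L \<iota>"

lemma out_arcs_cocone_image_subset: "out_arcs U v \<subseteq> out_arcs L v"
  using CK_arcs(1)[OF CKGr_cocone_CK[OF coc]] by (auto simp: out_arcs_def)

text \<open>By the CK condition for \<open>\<iota> i\<close>, the edges that leave the image of a
  regular vertex in \<open>L\<close> all come from \<open>E i\<close>, so they already belong to the
  union of the images.\<close>

lemma out_arcs_image_regular:
  assumes "i \<in> I" "regular_vertex (E i) w"
  shows "snd (\<iota> i) ` out_arcs (E i) w = out_arcs L (fst (\<iota> i) w)"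
    "out_arcs U (fst (\<iota> i) w) = out_arcs L (fst (\<iota> i) w)"
proof -
  show *: "snd (\<iota> i) ` out_arcs (E i) w = out_arcs L (fst (\<iota> i) w)"
    using CK_regular[OF CKGr_cocone_CK[OF coc assms(1)] assms(2)] by simp
  have "out_arcs L (fst (\<iota> i) w) \<subseteq> arcs U"
    unfolding *[symmetric] using assms(1) by (auto simp: out_arcs_def)
  then have "out_arcs L (fst (\<iota> i) w) \<subseteq> out_arcs U (fst (\<iota> i) w)"
    by (auto simp: out_arcs_def simp del: cocone_image_simps(2))
  then show "out_arcs U (fst (\<iota> i) w) = out_arcs L (fst (\<iota> i) w)"
    using out_arcs_cocone_image_subset by blast
qed

text \<open>This is the CK condition for the inclusion of \<open>U\<close> into \<open>L\<close>. A
  regular \<open>v\<close> has a preimage \<open>w\<close> in some \<open>E i\<close> that emits an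
  edge; injectivity on edges bounds the emission of \<open>w\<close> by that of \<open>v\<close>, so
  \<open>w\<close> is regular and \<open>out_arcs_image_regular\<close> applies.\<close>

lemma out_arcs_cocone_image:
  assumes v: "regular_vertex U v"
  shows "out_arcs U v = out_arcs L v"
proof -
  \<comment> \<open>The index is chosen through an edge leaving \<open>v\<close>, not through
    \<open>v\<close> itself, because a preimage of \<open>v\<close> over another index may be a
    sink.\<close>
  obtain i e where i: "i \<in> I" and e: "e \<in> arcs (E i)" "tail L (snd (\<iota> i) e) = v"
    using v by (auto simp: regular_vertex_iff out_arcs_def)
  note ck = CKGr_cocone_CK[OF coc i]
  define w where "w = tail (E i) e"
  have wf: "wf_digraph (E i)" using sys i by (simp add: CKGr_direct_system_def)
  have w: "fst (\<iota> i) w = v" "w \<in> verts (E i)" "e \<in> out_arcs (E i) w"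
    using CK_arcs[OF ck e(1)] e wf_digraph.tail_in_verts[OF wf e(1)] by (auto simp: w_def out_arcs_def)
  have "snd (\<iota> i) ` out_arcs (E i) w \<subseteq> out_arcs U v"
    using CK_out_arcs[OF ck, of w] w(1) i by (auto simp: out_arcs_def)
  then have "finite (snd (\<iota> i) ` out_arcs (E i) w)"
    using v by (auto simp: regular_vertex_iff intro: finite_subset)
  then have "finite (out_arcs (E i) w)"
    using CK_inj[OF ck] out_arcs_subset by (meson finite_imageD inj_on_subset)
  then have "regular_vertex (E i) w"
    using w by (auto simp: regular_vertex_iff)
  from out_arcs_image_regular(2)[OF i this] show ?thesis using w by simp
qed

lemma wf_cocone_image: "wf_digraph U"
proof
  fix e assume "e \<in> arcs U"
  then obtain i e' where i: "i \<in> I" and e: "e = snd (\<iota> i) e'" "e' \<in> arcs (E i)"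
    by auto
  have wf: "wf_digraph (E i)" using sys i by (simp add: CKGr_direct_system_def)
  show "tail U e \<in> verts U" "head U e \<in> verts U"
    using i e CK_arcs[OF CKGr_cocone_CK[OF coc i] e(2)] wf_digraph.tail_in_verts[OF wf e(2)]
      wf_digraph.head_in_verts[OF wf e(2)] by auto
qed

lemma CKGr_cocone_cocone_image: "CKGr_cocone I r E \<phi> U \<iota>"
proof -
  have "CK_morphism (E i) U (\<iota> i)" if i: "i \<in> I" for i
  proof -
    note ck = CKGr_cocone_CK[OF coc i]
    have "bij_betw (snd (\<iota> i)) (out_arcs (E i) v) (out_arcs U (fst (\<iota> i) v))"
      if "regular_vertex (E i) v" for v
      using ck that out_arcs_image_regular[OF i that] by (simp add: CK_morphism_def)
    then show ?thesis
      using ck i by (auto simp: CK_morphism_def graph_morphism_def)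
  qed
  then show ?thesis
    using coc wf_cocone_image by (simp add: CKGr_cocone_def)
qed

text \<open>This is composition with the inclusion of \<open>U\<close> into \<open>L\<close>.
  Regular vertices of \<open>G\<close> go to regular vertices of \<open>U\<close>, and at those
  \<open>U\<close> and \<open>L\<close> have the same outgoing edges.\<close>

lemma CK_into_cocone_image:
  assumes "CK_morphism G U \<eta>"
  shows "CK_morphism G L \<eta>"
proof -
  have "verts U \<subseteq> verts L" "arcs U \<subseteq> arcs L"
    using CK_verts[OF CKGr_cocone_CK[OF coc]] CK_arcs(1)[OF CKGr_cocone_CK[OF coc]] by auto
  then have "fst \<eta> ` verts G \<subseteq> verts L" "snd \<eta> ` arcs G \<subseteq> arcs L"
    using CK_verts[OF assms] CK_arcs(1)[OF assms] by blast+
  moreover have "out_arcs U (fst \<eta> v) = out_arcs L (fst \<eta> v)" if "regular_vertex G v" for v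
    using CK_regular(1)[OF assms that] by (rule out_arcs_cocone_image)
  ultimately show ?thesis
    using assms by (simp add: CK_morphism_def graph_morphism_def)
qed

end

lemma CK_morphism_id: "CK_morphism G G graph_map_id"
  by (auto simp: CK_morphism_def graph_morphism_def graph_map_id_def)

text \<open>The universal property yields a map from \<open>L\<close> to the union of the images;
  followed by the inclusion it is an endomorphism of \<open>L\<close> compatible with
  \<open>\<iota>\<close>, hence the identity. The union is a graph of the same type as
  \<open>L\<close>, so the instance at that type suffices.\<close>

lemma CKGr_direct_limit_covered:
  fixes L :: "('w,'f) pre_digraph"
  assumes sys: "CKGr_direct_system I r E \<phi>"
    and lim: "CKGr_direct_limit TYPE(('w,'f) pre_digraph) I r E \<phi> L \<iota>"
  shows "verts L = (\<Union>i\<in>I. fst (\<iota> i) ` verts (E i))" "arcs L = (\<Union>i\<in>I. snd (\<iota> i) ` arcs (E i))"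
proof -
  have coc: "CKGr_cocone I r E \<phi> L \<iota>"
    using lim by (simp add: CKGr_direct_limit_def)
  let ?U = "cocone_image I E L \<iota>"
  have "CKGr_cocone I r E \<phi> ?U \<iota>"
    by (rule CKGr_cocone_cocone_image[OF sys coc])
  then obtain \<eta> where \<eta>: "CK_morphism L ?U \<eta>"
      "\<forall>i\<in>I. graph_map_eq (E i) (graph_map_comp \<eta> (\<iota> i)) (\<iota> i)"
    using lim unfolding CKGr_direct_limit_def by blast
  \<comment> \<open>Here \<open>\<xi>\<close> is the unique factorisation of \<open>\<iota>\<close>
    through itself, with which both \<open>\<eta>\<close> and the identity are compared.\<close>
  obtain \<xi> where \<xi>: "\<forall>\<theta>. CK_morphism L L \<theta> \<and>
      (\<forall>i\<in>I. graph_map_eq (E i) (graph_map_comp \<theta> (\<iota> i)) (\<iota> i)) \<longrightarrow> graph_map_eq L \<theta> \<xi>"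
    using lim coc unfolding CKGr_direct_limit_def by blast
  have "graph_map_eq L \<eta> \<xi>"
    using \<xi> \<eta>(2) CK_into_cocone_image[OF sys coc \<eta>(1)] by blast
  moreover have "graph_map_eq L graph_map_id \<xi>"
    using \<xi>[rule_format, of graph_map_id] CK_morphism_id[of L]
    by (auto simp: graph_map_eq_def graph_map_comp_def graph_map_id_def)
  ultimately have *: "\<And>v. v \<in> verts L \<Longrightarrow> fst \<eta> v = v" "\<And>e. e \<in> arcs L \<Longrightarrow> snd \<eta> e = e"
    by (simp_all add: graph_map_eq_def graph_map_id_def)
  have "verts L \<subseteq> verts ?U"
    using CK_verts[OF \<eta>(1)] *(1) by fastforce
  then show "verts L = (\<Union>i\<in>I. fst (\<iota> i) ` verts (E i))"
    using CK_verts[OF CKGr_cocone_CK[OF coc]] by auto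
  have "arcs L \<subseteq> arcs ?U"
    using CK_arcs(1)[OF \<eta>(1)] *(2) by fastforce
  then show "arcs L = (\<Union>i\<in>I. snd (\<iota> i) ` arcs (E i))"
    using CK_arcs(1)[OF CKGr_cocone_CK[OF coc]] by auto
qed

section \<open>The monoid of a covered cocone\<close>

text \<open>An injective map on edges is also injective on sets of edges, which settles the
  generators \<open>GenInf v S\<close>. The injectivity lets equality of words be tested after
  mapping them into the limit.\<close>

lemma Mbar_gen_map_inj_on:
  assumes "CK_morphism G H \<eta>"
  shows "inj_on (Mbar_gen_map \<eta>) (Mbar_gens G)"
proof (rule inj_onI)
  fix x y assume xy: "x \<in> Mbar_gens G" "y \<in> Mbar_gens G" "Mbar_gen_map \<eta> x = Mbar_gen_map \<eta> y"
  note inj = CK_inj[OF assms]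
  show "x = y"
  proof (cases x)
    case (Gen v)
    then obtain w where "y = Gen w" "fst \<eta> v = fst \<eta> w"
      using xy(3) by (cases y) auto
    with Gen xy(1,2) inj show ?thesis
      by (auto simp: Mbar_gens_def dest: inj_onD)
  next
    case (GenInf v S)
    then obtain w T where y: "y = GenInf w T" "fst \<eta> v = fst \<eta> w" "snd \<eta> ` S = snd \<eta> ` T"
      using xy(3) by (cases y) auto
    have "v \<in> verts G" "w \<in> verts G" "S \<subseteq> arcs G" "T \<subseteq> arcs G"
      using GenInf y(1) xy(1,2) out_arcs_subset
      by (auto simp: Mbar_gens_def infinite_emitter_def emission_sets_def out_arcs_def)
    then show ?thesis
      using GenInf y inj by (auto dest: inj_onD simp: inj_on_image_eq_iff)
  qed
qed

text \<open>The two covering equations are the form in which the universal property of the graph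
  \<open>L\<close> enters the study of its monoid.\<close>

locale covered_cocone =
  fixes I :: "'i set" and r :: "'i rel"
    and E :: "'i \<Rightarrow> ('v,'e) pre_digraph" and \<phi> :: "'i \<Rightarrow> 'i \<Rightarrow> ('v,'e,'v,'e) graph_map"
    and L :: "('w,'f) pre_digraph" and \<iota> :: "'i \<Rightarrow> ('v,'e,'w,'f) graph_map"
  assumes sys: "CKGr_direct_system I r E \<phi>"
    and coc: "CKGr_cocone I r E \<phi> L \<iota>"
    and verts_covered: "verts L = (\<Union>i\<in>I. fst (\<iota> i) ` verts (E i))"
    and arcs_covered: "arcs L = (\<Union>i\<in>I. snd (\<iota> i) ` arcs (E i))"
begin

abbreviation "gmap i \<equiv> Mbar_gen_map (\<iota> i)"
abbreviation "gens i \<equiv> Mbar_gens (E i)"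

lemma dir: "directed_index I r"
  using sys by (simp add: CKGr_direct_system_def)

lemma r_I: "(i, j) \<in> r \<Longrightarrow> i \<in> I \<and> j \<in> I"
  using dir by (auto simp: directed_index_def preorder_on_def refl_on_def)

lemma bound: "i \<in> I \<Longrightarrow> j \<in> I \<Longrightarrow> \<exists>k\<in>I. (i, k) \<in> r \<and> (j, k) \<in> r"
  using dir by (simp add: directed_index_def)

lemma CK_\<phi>: "(i, j) \<in> r \<Longrightarrow> CK_morphism (E i) (E j) (\<phi> i j)"
  using sys by (simp add: CKGr_direct_system_def)

lemma CK_\<iota>: "i \<in> I \<Longrightarrow> CK_morphism (E i) L (\<iota> i)"
  by (rule CKGr_cocone_CK[OF coc])

lemma wf_E: "i \<in> I \<Longrightarrow> wf_digraph (E i)"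
  using sys by (simp add: CKGr_direct_system_def)

lemma wf_L: "wf_digraph L"
  using coc by (simp add: CKGr_cocone_def)

lemma \<iota>_\<phi>: "(i, j) \<in> r \<Longrightarrow> graph_map_eq (E i) (graph_map_comp (\<iota> j) (\<phi> i j)) (\<iota> i)"
  using coc by (simp add: CKGr_cocone_def)

section \<open>Lifting generators, words and relations to a single index\<close>

lemma gmap_\<phi>:
  assumes "(i, j) \<in> r" "set_mset a \<subseteq> gens i"
  shows "image_mset (gmap j) (image_mset (Mbar_gen_map (\<phi> i j)) a) = image_mset (gmap i) a"
  using assms Mbar_gen_map_cong[OF \<iota>_\<phi>[OF assms(1)]]
  by (auto simp: image_mset.compositionality Mbar_gen_map_comp intro!: image_mset_cong)

text \<open>Directedness gives one index over which the vertex and the finitely many edges all have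
  preimages; injectivity on vertices then forces the lifted edges to start at the lifted
  vertex.\<close>

lemma lift_vertex_arcs:
  assumes v: "v \<in> verts L" and S: "finite S" "S \<subseteq> out_arcs L v"
  obtains i w S' where "i \<in> I" "w \<in> verts (E i)" "S' \<subseteq> out_arcs (E i) w"
    "fst (\<iota> i) w = v" "snd (\<iota> i) ` S' = S"
proof -
  \<comment> \<open>The disjoint sum collects vertices and edges, so that a single application of
    \<open>directed_finite_subset\<close> catches \<open>v\<close> and \<open>S\<close>
    together.\<close>
  define X where "X i = fst (\<iota> i) ` verts (E i) <+> snd (\<iota> i) ` arcs (E i)" for i
  have "X i \<subseteq> X j" if ij: "(i, j) \<in> r" for i j
  proof -
    have "fst (\<iota> i) w = fst (\<iota> j) (fst (\<phi> i j) w)" if "w \<in> verts (E i)" for w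
      using \<iota>_\<phi>[OF ij] that by (simp add: graph_map_eq_def graph_map_comp_def)
    moreover have "snd (\<iota> i) e = snd (\<iota> j) (snd (\<phi> i j) e)" if "e \<in> arcs (E i)" for e
      using \<iota>_\<phi>[OF ij] that by (simp add: graph_map_eq_def graph_map_comp_def)
    ultimately show ?thesis
      using CK_verts[OF CK_\<phi>[OF ij]] CK_arcs(1)[OF CK_\<phi>[OF ij]] by (auto simp: X_def)
  qed
  then have mono: "\<forall>(i, j)\<in>r. X i \<subseteq> X j"
    by blast
  have v': "v \<in> (\<Union>i\<in>I. fst (\<iota> i) ` verts (E i))"
    using v by (simp only: verts_covered)
  have S': "S \<subseteq> (\<Union>i\<in>I. snd (\<iota> i) ` arcs (E i))"
    using order_trans[OF S(2) out_arcs_subset] by (simp only: arcs_covered)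
  have sub: "{v} <+> S \<subseteq> (\<Union>i\<in>I. X i)"
  proof
    fix z assume "z \<in> {v} <+> S"
    then consider "z = Inl v" | e where "z = Inr e" "e \<in> S"
      by auto
    then show "z \<in> (\<Union>i\<in>I. X i)"
    proof cases
      case 1
      with v' show ?thesis by (auto simp: X_def)
    next
      case 2
      from S' 2(2) have "e \<in> (\<Union>i\<in>I. snd (\<iota> i) ` arcs (E i))" by (rule subsetD)
      with 2 show ?thesis by (auto simp: X_def)
    qed
  qed
  have "finite ({v} <+> S)"
    using S(1) by simp
  then obtain i where i: "i \<in> I" and sub: "{v} <+> S \<subseteq> X i"
    by (rule directed_finite_subset[where X = X, OF dir mono _ sub])
  then obtain w where w: "w \<in> verts (E i)" "fst (\<iota> i) w = v"
    by (auto simp: X_def)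
  have "S \<subseteq> snd (\<iota> i) ` arcs (E i)"
    using sub by (auto simp: X_def)
  then obtain S' where S': "S' \<subseteq> arcs (E i)" "snd (\<iota> i) ` S' = S"
    by (metis subset_imageE)
  have "tail (E i) e = w" if "e \<in> S'" for e
  proof (rule inj_onD)
    show "inj_on (fst (\<iota> i)) (verts (E i))" using CK_inj[OF CK_\<iota>[OF i]] by simp
    have "snd (\<iota> i) e \<in> out_arcs L v" using S(2) S' that by blast
    then show "fst (\<iota> i) (tail (E i) e) = fst (\<iota> i) w"
      using CK_arcs(2)[OF CK_\<iota>[OF i]] S' that w by auto
    show "tail (E i) e \<in> verts (E i)"
      using wf_digraph.tail_in_verts[OF wf_E[OF i]] S' that by blast
  qed (rule w(1))
  then have "S' \<subseteq> out_arcs (E i) w"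
    using S' by (auto simp: out_arcs_def)
  with that i w S' show thesis by blast
qed

text \<open>The preimage \<open>w\<close> is not regular, since CK-morphisms preserve regularity,
  and it is not a sink, since \<open>S\<close> is nonempty and its lift starts at \<open>w\<close>.
  Without an edge to lift, an infinite emitter could have a sink as its preimage.\<close>

lemma lift_emission:
  assumes v: "infinite_emitter L v" and S: "finite S" "S \<noteq> {}" "S \<subseteq> out_arcs L v"
  obtains i w S' where "i \<in> I" "infinite_emitter (E i) w" "finite S'" "S' \<subseteq> out_arcs (E i) w"
    "fst (\<iota> i) w = v" "snd (\<iota> i) ` S' = S"
proof -
  have "v \<in> verts L" using v by (simp add: infinite_emitter_def)
  then obtain i w S' where i: "i \<in> I" "w \<in> verts (E i)" "S' \<subseteq> out_arcs (E i) w"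
    "fst (\<iota> i) w = v" "snd (\<iota> i) ` S' = S"
    by (rule lift_vertex_arcs[OF _ S(1,3)])
  have "\<not> regular_vertex (E i) w"
    using CK_regular(1)[OF CK_\<iota>[OF i(1)], of w] i(4) v
    by (auto simp: regular_vertex_iff infinite_emitter_def)
  then have "infinite_emitter (E i) w"
    using i S(2) by (auto simp: regular_vertex_iff infinite_emitter_def)
  moreover have "finite S'"
    using i CK_inj[OF CK_\<iota>[OF i(1)]] S(1) out_arcs_subset by (metis finite_imageD inj_on_subset)
  ultimately show thesis using that i by blast
qed

lemma lift_regular:
  assumes v: "regular_vertex L v"
  obtains i w where "i \<in> I" "regular_vertex (E i) w" "fst (\<iota> i) w = v"
proof -
  have v': "v \<in> verts L" "finite (out_arcs L v)" "out_arcs L v \<noteq> {}"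
    using v by (auto simp: regular_vertex_iff)
  obtain i w S' where i: "i \<in> I" "w \<in> verts (E i)" "S' \<subseteq> out_arcs (E i) w"
    "fst (\<iota> i) w = v" "snd (\<iota> i) ` S' = out_arcs L v"
    \<comment> \<open>All edges leaving \<open>v\<close> are lifted; as there is at least one,
      \<open>w\<close> is not a sink.\<close>
    by (rule lift_vertex_arcs[OF v'(1,2) subset_refl])
  have "\<not> infinite_emitter (E i) w"
    using CK_infinite_emitter[OF CK_\<iota>[OF i(1)], of w] i(4) v'
    by (auto simp: infinite_emitter_def)
  then have "regular_vertex (E i) w"
    using i v'(3) by (auto simp: regular_vertex_iff infinite_emitter_def)
  with that i show thesis by blast
qed

lemma gens_covered: "Mbar_gens L \<subseteq> (\<Union>i\<in>I. gmap i ` gens i)"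
proof
  fix x assume "x \<in> Mbar_gens L"
  then consider v where "x = Gen v" "v \<in> verts L"
    | v S where "x = GenInf v S" "infinite_emitter L v" "S \<in> emission_sets L v"
    by (auto simp: Mbar_gens_def)
  then show "x \<in> (\<Union>i\<in>I. gmap i ` gens i)"
  proof cases
    case 1
    then obtain i w where "i \<in> I" "w \<in> verts (E i)" "v = fst (\<iota> i) w"
      using verts_covered by auto
    then show ?thesis
      using 1 by (auto simp: Mbar_gens_def intro!: bexI[of _ i] image_eqI[of _ _ "Gen w"])
  next
    case 2
    then have "finite S" "S \<noteq> {}" "S \<subseteq> out_arcs L v"
      by (auto simp: emission_sets_def)
    from lift_emission[OF 2(2) this] obtain i w S' where
      i: "i \<in> I" "infinite_emitter (E i) w" "finite S'" "S' \<subseteq> out_arcs (E i) w"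
      "fst (\<iota> i) w = v" "snd (\<iota> i) ` S' = S" .
    then have "GenInf w S' \<in> gens i"
      using \<open>S \<noteq> {}\<close> by (auto simp: Mbar_gens_def emission_sets_def)
    then show ?thesis
      using 2(1) i by (intro UN_I[of i] image_eqI[of _ _ "GenInf w S'"]) auto
  qed
qed

text \<open>A word has finitely many letters and the images of the generators grow along
  \<open>r\<close>, so all letters have preimages over one index; the word is then pulled back
  letter by letter.\<close>

lemma lift_word:
  assumes "set_mset a \<subseteq> Mbar_gens L"
  obtains i a' where "i \<in> I" "set_mset a' \<subseteq> gens i" "image_mset (gmap i) a' = a"
proof -
  have "gmap i ` gens i \<subseteq> gmap j ` gens j" if ij: "(i, j) \<in> r" for i j
  proof
    fix y assume "y \<in> gmap i ` gens i"
    then obtain x where x: "x \<in> gens i" "y = gmap i x" by blast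
    then have "y = gmap j (Mbar_gen_map (\<phi> i j) x)" "Mbar_gen_map (\<phi> i j) x \<in> gens j"
      using gmap_\<phi>[OF ij, of "{#x#}"] CK_gens[OF CK_\<phi>[OF ij], of "{#x#}"] by auto
    then show "y \<in> gmap j ` gens j" by blast
  qed
  then have mono: "\<forall>(i, j)\<in>r. gmap i ` gens i \<subseteq> gmap j ` gens j"
    by blast
  obtain i where i: "i \<in> I" "set_mset a \<subseteq> gmap i ` gens i"
    by (rule directed_finite_subset[where X = "\<lambda>i. gmap i ` gens i", OF dir mono finite_set_mset
          order_trans[OF assms gens_covered]])
  define a' where "a' = image_mset (inv_into (gens i) (gmap i)) a"
  have "image_mset (gmap i) a' = image_mset (\<lambda>x. x) a"
    unfolding a'_def image_mset.compositionality
    using i(2) by (intro image_mset_cong) (auto simp: f_inv_into_f)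
  moreover have "set_mset a' \<subseteq> gens i"
    using i by (auto simp: a'_def intro: inv_into_into)
  ultimately show thesis using that i by simp
qed

text \<open>At a common upper bound \<open>k\<close> both words have the same image in the limit,
  and there \<open>gmap k\<close> is injective on generators, so they already coincide.\<close>

lemma lift_word_unique:
  assumes i: "i \<in> I" "set_mset a \<subseteq> gens i" and j: "j \<in> I" "set_mset b \<subseteq> gens j"
    and eq: "image_mset (gmap i) a = image_mset (gmap j) b"
  obtains k where "(i, k) \<in> r" "(j, k) \<in> r"
    "image_mset (Mbar_gen_map (\<phi> i k)) a = image_mset (Mbar_gen_map (\<phi> j k)) b"
proof -
  obtain k where k: "k \<in> I" "(i, k) \<in> r" "(j, k) \<in> r"
    using bound i(1) j(1) by blast
  let ?a = "image_mset (Mbar_gen_map (\<phi> i k)) a" and ?b = "image_mset (Mbar_gen_map (\<phi> j k)) b"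
  have sub: "set_mset ?a \<subseteq> gens k" "set_mset ?b \<subseteq> gens k"
    using CK_gens[OF CK_\<phi>] k i j by blast+
  have "image_mset (gmap k) ?a = image_mset (gmap k) ?b"
    using gmap_\<phi> k i j eq by simp
  then have "?a = ?b"
    using sub Mbar_gen_map_inj_on[OF CK_\<iota>[OF k(1)]]
    by (intro multiset.inj_map_strong[of ?a ?b "gmap k" "gmap k"]) (auto dest: inj_onD)
  with that k show thesis by blast
qed

lemma lift_rel:
  assumes "(a, b) \<in> Mbar_rels L"
  obtains i a' b' where "i \<in> I" "(a', b') \<in> Mbar_rels (E i)"
    "a = image_mset (gmap i) a'" "b = image_mset (gmap i) b'"
  using assms
proof (cases rule: Mbar_relsE)
  case (regular v)
  obtain i w where i: "i \<in> I" "regular_vertex (E i) w" "fst (\<iota> i) w = v"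
    by (rule lift_regular[OF regular(1)])
  have "({#Gen w#}, range_sum (E i) (out_arcs (E i) w)) \<in> Mbar_rels (E i)"
    using i by (auto simp: Mbar_rels_def)
  \<comment> \<open>By the CK condition the edges leaving \<open>w\<close> map onto all edges
    leaving \<open>v\<close>, so no summand is missing.\<close>
  moreover have "image_mset (gmap i) (range_sum (E i) (out_arcs (E i) w)) = b"
    using i regular CK_regular(2)[OF CK_\<iota>[OF i(1)] i(2)]
      CK_range_sum[OF CK_\<iota>[OF i(1)] _ out_arcs_subset[of "E i" w]]
    by (simp add: regular_vertex_iff)
  ultimately show thesis using that i regular by simp
next
  case (vertex v S)
  then have S: "finite S" "S \<noteq> {}" "S \<subseteq> out_arcs L v"
    by (auto simp: emission_sets_def)
  obtain i w S' where i: "i \<in> I" "infinite_emitter (E i) w" "finite S'" "S' \<subseteq> out_arcs (E i) w"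
    "fst (\<iota> i) w = v" "snd (\<iota> i) ` S' = S"
    by (rule lift_emission[OF vertex(1) S])
  have "({#GenInf w S'#} + range_sum (E i) S', {#Gen w#}) \<in> Mbar_rels (E i)"
    using i S unfolding Mbar_rels_def emission_sets_def by (intro UnI1 UnI2) auto
  moreover have "image_mset (gmap i) (range_sum (E i) S') = range_sum L S"
    using CK_range_sum[OF CK_\<iota>[OF i(1)] i(3)] i out_arcs_subset by (metis order_trans)
  ultimately show thesis using that i vertex by simp
next
  case (swap v S T)
  \<comment> \<open>The union is lifted in one go, so that the preimages of \<open>S\<close> and
    \<open>T\<close> lie over the same index and leave the same vertex.\<close>
  then have ST: "finite (S \<union> T)" "S \<union> T \<noteq> {}" "S \<union> T \<subseteq> out_arcs L v" "S \<noteq> {}" "T \<noteq> {}"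
    by (auto simp: emission_sets_def)
  obtain i w V where i: "i \<in> I" "infinite_emitter (E i) w" "finite V" "V \<subseteq> out_arcs (E i) w"
    "fst (\<iota> i) w = v" "snd (\<iota> i) ` V = S \<union> T"
    by (rule lift_emission[OF swap(1) ST(1-3)])
  have V: "V \<subseteq> arcs (E i)"
    by (rule order_trans[OF i(4) out_arcs_subset])
  obtain S' T' where S': "S' \<subseteq> V" "S = snd (\<iota> i) ` S'" and T': "T' \<subseteq> V" "T = snd (\<iota> i) ` T'"
    using i(6) by (metis Un_upper1 Un_upper2 subset_imageE)
  have em: "S' \<in> emission_sets (E i) w" "T' \<in> emission_sets (E i) w"
    using S' T' i ST by (auto simp: emission_sets_def intro: finite_subset)
  have inj: "inj_on (snd (\<iota> i)) V"
    by (rule inj_on_subset[OF conjunct2[OF CK_inj[OF CK_\<iota>[OF i(1)]]] V])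
  \<comment> \<open>Injectivity on \<open>V\<close> makes taking images commute with set
    difference.\<close>
  have diff: "image_mset (gmap i) (range_sum (E i) (A - B)) = range_sum L (snd (\<iota> i) ` A - snd (\<iota> i) ` B)"
    if "A \<subseteq> V" "B \<subseteq> V" for A B
  proof -
    have "A - B \<subseteq> V" "finite (A - B)" using that(1) i(3) by (auto intro: finite_subset)
    then show ?thesis
      using CK_range_sum[OF CK_\<iota>[OF i(1)], of "A - B"] V inj_on_image_set_diff[OF inj _ that(2), of A]
      by auto
  qed
  have "({#GenInf w S'#} + range_sum (E i) (S' - T'), {#GenInf w T'#} + range_sum (E i) (T' - S'))
      \<in> Mbar_rels (E i)"
    using i em unfolding Mbar_rels_def by (intro UnI2) auto
  then show thesis
    using that i swap diff[OF S'(1) T'(1)] diff[OF T'(1) S'(1)] S' T' by simp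
qed

section \<open>Factoring a competing cocone through the monoid of the limit\<close>

context
  fixes N :: "'c monoid" and \<kappa> :: "'i \<Rightarrow> ('v,'e) Mbar_elt \<Rightarrow> 'c"
  assumes N: "CMon_cocone I r (\<lambda>i. Mbar (E i)) (\<lambda>i j. Mbar_map (E j) (\<phi> i j)) N \<kappa>"
begin

text \<open>The factorisation on the level of words: lift the word to some index and apply
  \<open>\<kappa>\<close> there. The choice is harmless because the value is independent of the
  lift, as \<open>word_value\<close> shows.\<close>

definition word_value :: "('w,'f) Mbar_gen multiset \<Rightarrow> 'c" where
  "word_value a = (SOME m. \<exists>i\<in>I. \<exists>a'. set_mset a' \<subseteq> gens i \<and> image_mset (gmap i) a' = a \<and>
     m = \<kappa> i (Mbar_class (E i) a'))"

lemma hom_\<kappa>: "i \<in> I \<Longrightarrow> CMon_hom (Mbar (E i)) N (\<kappa> i)"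
  using N by (simp add: CMon_cocone_def)

lemma class_carrier: "set_mset a \<subseteq> gens i \<Longrightarrow> Mbar_class (E i) a \<in> carrier (Mbar (E i))"
  by (simp add: Mbar_carrier)

lemma \<kappa>_\<phi>:
  assumes "(i, j) \<in> r" "set_mset a \<subseteq> gens i"
  shows "\<kappa> j (Mbar_class (E j) (image_mset (Mbar_gen_map (\<phi> i j)) a)) = \<kappa> i (Mbar_class (E i) a)"
  using N assms class_carrier Mbar_map_class[OF CK_\<phi>[OF assms(1)] assms(2)]
  unfolding CMon_cocone_def by metis

text \<open>Any two lifts of a word agree at a common later index, and \<open>\<kappa>\<close> is
  compatible with the transition maps.\<close>

lemma word_value:
  assumes i: "i \<in> I" "set_mset a \<subseteq> gens i"
  shows "word_value (image_mset (gmap i) a) = \<kappa> i (Mbar_class (E i) a)"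
  unfolding word_value_def
proof (rule someI2)
  show "\<exists>j\<in>I. \<exists>a'. set_mset a' \<subseteq> gens j \<and> image_mset (gmap j) a' = image_mset (gmap i) a \<and>
     \<kappa> i (Mbar_class (E i) a) = \<kappa> j (Mbar_class (E j) a')"
    using i by blast
next
  fix m
  assume "\<exists>j\<in>I. \<exists>a'. set_mset a' \<subseteq> gens j \<and> image_mset (gmap j) a' = image_mset (gmap i) a \<and>
     m = \<kappa> j (Mbar_class (E j) a')"
  then obtain j b where j: "j \<in> I" "set_mset b \<subseteq> gens j" "image_mset (gmap j) b = image_mset (gmap i) a"
    "m = \<kappa> j (Mbar_class (E j) b)"
    by blast
  obtain k where "(j, k) \<in> r" "(i, k) \<in> r"
    "image_mset (Mbar_gen_map (\<phi> j k)) b = image_mset (Mbar_gen_map (\<phi> i k)) a"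
    by (rule lift_word_unique[OF j(1,2) i j(3)])
  then show "m = \<kappa> i (Mbar_class (E i) a)"
    using \<kappa>_\<phi> i j by metis
qed

lemma word_value_carrier:
  assumes "set_mset a \<subseteq> Mbar_gens L"
  shows "word_value a \<in> carrier N"
  by (rule lift_word[OF assms]) (metis word_value CMon_hom_carrier class_carrier hom_\<kappa>)

lemma word_value_add:
  assumes "set_mset a \<subseteq> Mbar_gens L" "set_mset b \<subseteq> Mbar_gens L"
  shows "word_value (a + b) = word_value a \<otimes>\<^bsub>N\<^esub> word_value b"
proof -
  \<comment> \<open>The sum is lifted rather than its summands; splitting the lifted word gives
    lifts of \<open>a\<close> and \<open>b\<close> over the same index.\<close>
  have "set_mset (a + b) \<subseteq> Mbar_gens L" using assms by simp
  then obtain i c where i: "i \<in> I" "set_mset c \<subseteq> gens i" "image_mset (gmap i) c = a + b"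
    by (rule lift_word)
  then obtain a' b' where ab: "c = a' + b'" "image_mset (gmap i) a' = a" "image_mset (gmap i) b' = b"
    by (metis image_mset_eq_plusD)
  then have sub: "set_mset a' \<subseteq> gens i" "set_mset b' \<subseteq> gens i" using i by auto
  have "word_value (a + b) = \<kappa> i (Mbar_class (E i) a' \<otimes>\<^bsub>Mbar (E i)\<^esub> Mbar_class (E i) b')"
    using word_value[OF i(1,2)] i(3) ab(1) by (simp add: Mbar_mult[OF sub])
  also have "\<dots> = \<kappa> i (Mbar_class (E i) a') \<otimes>\<^bsub>N\<^esub> \<kappa> i (Mbar_class (E i) b')"
    using hom_\<kappa>[OF i(1)] class_carrier[OF sub(1)] class_carrier[OF sub(2)]
    by (auto simp: CMon_hom_def hom_mult)
  also have "\<dots> = word_value a \<otimes>\<^bsub>N\<^esub> word_value b"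
    using word_value[OF i(1) sub(1)] word_value[OF i(1) sub(2)] ab by simp
  finally show ?thesis .
qed

lemma word_value_empty: "word_value {#} = \<one>\<^bsub>N\<^esub>"
proof -
  obtain i where i: "i \<in> I" using dir by (auto simp: directed_index_def)
  show ?thesis
    using word_value[OF i, of "{#}"] hom_\<kappa>[OF i] by (simp add: CMon_hom_def Mbar_one)
qed

text \<open>A defining relation of the limit lifts to a defining relation over some
  \<open>E i\<close>, whose two sides have the same class before \<open>\<kappa> i\<close> is
  applied. The closure rules of the congruence follow by induction.\<close>

lemma word_value_cong:
  assumes "(a, b) \<in> cmon_cong (Mbar_gens L) (Mbar_rels L)"
  shows "word_value a = word_value b"
  using assms
proof (induction rule: cmon_cong.induct)
  case (rel a b)
  then obtain i a' b' where i: "i \<in> I" "(a', b') \<in> Mbar_rels (E i)"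
    "a = image_mset (gmap i) a'" "b = image_mset (gmap i) b'"
    by (rule lift_rel)
  have sub: "set_mset a' \<subseteq> gens i" "set_mset b' \<subseteq> gens i"
    using Mbar_rels_words[OF wf_E[OF i(1)] i(2)] by auto
  have "Mbar_class (E i) a' = Mbar_class (E i) b'"
    unfolding Mbar_class_def using sub i(2) by (simp add: cmon_class_eq_iff cmon_cong.rel)
  then show ?case using word_value[OF i(1)] sub i(3,4) by simp
next
  case (add a b c d)
  \<comment> \<open>Additivity of \<open>word_value\<close> holds for words over the generators of
    \<open>L\<close>, and congruent words are of this kind.\<close>
  note words = cmon_cong_words[OF Mbar_rels_words[OF wf_L]]
  show ?case using add.IH words[OF _ add.hyps(1)] words[OF _ add.hyps(2)] by (simp add: word_value_add)
qed simp_all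

lemma Mbar_factor:
  obtains h where "CMon_hom (Mbar L) N h"
    "\<And>i x. i \<in> I \<Longrightarrow> x \<in> carrier (Mbar (E i)) \<Longrightarrow> h (Mbar_map L (\<iota> i) x) = \<kappa> i x"
proof
  \<comment> \<open>Any representative of a class may be used, since \<open>word_value\<close> is
    constant on classes.\<close>
  define h where "h A = word_value (SOME a. a \<in> A)" for A
  have h: "h (Mbar_class L a) = word_value a" if "set_mset a \<subseteq> Mbar_gens L" for a
  proof -
    have "a \<in> Mbar_class L a"
      using that by (simp add: Mbar_class_def cmon_class_def cmon_cong.refl)
    then have "(SOME b. b \<in> Mbar_class L a) \<in> Mbar_class L a"
      by (rule someI)
    then show ?thesis
      unfolding h_def by (auto simp: Mbar_class_def cmon_class_def dest: word_value_cong)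
  qed
  show "CMon_hom (Mbar L) N h"
    unfolding CMon_hom_def
    by (auto intro!: homI simp: Mbar_carrier Mbar_mult Mbar_one h word_value_carrier word_value_add
        word_value_empty)
  show "h (Mbar_map L (\<iota> i) x) = \<kappa> i x" if "i \<in> I" "x \<in> carrier (Mbar (E i))" for i x
    using that CK_gens[OF CK_\<iota>] by (auto simp: Mbar_carrier Mbar_map_class[OF CK_\<iota>] h word_value)
qed

end

section \<open>The universal property of the monoid of the limit\<close>

lemma Mbar_carrier_covered:
  assumes "y \<in> carrier (Mbar L)"
  obtains i x where "i \<in> I" "x \<in> carrier (Mbar (E i))" "y = Mbar_map L (\<iota> i) x"
proof -
  obtain a where a: "y = Mbar_class L a" "set_mset a \<subseteq> Mbar_gens L"
    using assms by (auto simp: Mbar_carrier)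
  obtain i a' where i: "i \<in> I" "set_mset a' \<subseteq> gens i" "image_mset (gmap i) a' = a"
    by (rule lift_word[OF a(2)])
  then have "y = Mbar_map L (\<iota> i) (Mbar_class (E i) a')"
    using a by (simp add: Mbar_map_class[OF CK_\<iota>])
  with that i show thesis by (auto simp: Mbar_carrier)
qed

lemma CMon_cocone_Mbar:
  "CMon_cocone I r (\<lambda>i. Mbar (E i)) (\<lambda>i j. Mbar_map (E j) (\<phi> i j)) (Mbar L) (\<lambda>i. Mbar_map L (\<iota> i))"
proof -
  have "Mbar_map L (\<iota> j) (Mbar_map (E j) (\<phi> i j) x) = Mbar_map L (\<iota> i) x"
    if ij: "(i, j) \<in> r" and x: "x \<in> carrier (Mbar (E i))" for i j x
    using x r_I[OF ij] CK_gens[OF CK_\<phi>[OF ij]]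
    by (auto simp: Mbar_carrier Mbar_map_class[OF CK_\<iota>] Mbar_map_class[OF CK_\<phi>[OF ij]] gmap_\<phi>[OF ij])
  then show ?thesis
    unfolding CMon_cocone_def using comm_monoid_Mbar CMon_hom_Mbar_map[OF CK_\<iota>] by blast
qed

theorem CMon_direct_limit_Mbar:
  "CMon_direct_limit TYPE('c monoid) I r (\<lambda>i. Mbar (E i)) (\<lambda>i j. Mbar_map (E j) (\<phi> i j))
     (Mbar L) (\<lambda>i. Mbar_map L (\<iota> i))"
  unfolding CMon_direct_limit_def
proof (intro conjI allI impI CMon_cocone_Mbar)
  fix N :: "'c monoid" and \<kappa>
  assume "CMon_cocone I r (\<lambda>i. Mbar (E i)) (\<lambda>i j. Mbar_map (E j) (\<phi> i j)) N \<kappa>"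
  then obtain h where h: "CMon_hom (Mbar L) N h"
    "\<And>i x. i \<in> I \<Longrightarrow> x \<in> carrier (Mbar (E i)) \<Longrightarrow> h (Mbar_map L (\<iota> i) x) = \<kappa> i x"
    by (rule Mbar_factor) blast
  show "\<exists>h. CMon_hom (Mbar L) N h \<and>
      (\<forall>i\<in>I. \<forall>x\<in>carrier (Mbar (E i)). h (Mbar_map L (\<iota> i) x) = \<kappa> i x) \<and>
      (\<forall>g. CMon_hom (Mbar L) N g \<and>
        (\<forall>i\<in>I. \<forall>x\<in>carrier (Mbar (E i)). g (Mbar_map L (\<iota> i) x) = \<kappa> i x) \<longrightarrow>
        (\<forall>y\<in>carrier (Mbar L). g y = h y))"
    \<comment> \<open>Uniqueness holds because the images of the monoids \<open>Mbar (E i)\<close>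
      cover \<open>Mbar L\<close>.\<close>
    using h by (intro exI[of _ h]) (auto elim!: Mbar_carrier_covered)
qed

end

theorem lemma4p7:
  fixes I :: "'i set" and r :: "'i rel"
    and E :: "'i \<Rightarrow> ('v,'e) pre_digraph"
    and \<phi> :: "'i \<Rightarrow> 'i \<Rightarrow> ('v,'e,'v,'e) graph_map"
    and E_inf :: "('w,'f) pre_digraph"
    and \<phi>_inf :: "'i \<Rightarrow> ('v,'e,'w,'f) graph_map"
    and M_inf :: "'m monoid"
    and \<mu>_inf :: "'i \<Rightarrow> ('v,'e) Mbar_elt \<Rightarrow> 'm"
  assumes "CKGr_direct_system I r E \<phi>"
    and "CKGr_direct_limit TYPE(('w,'f) pre_digraph) I r E \<phi> E_inf \<phi>_inf"
    and "CMon_direct_limit TYPE('m monoid) I r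
           (\<lambda>i. Mbar (E i)) (\<lambda>i j. Mbar_map (E j) (\<phi> i j)) M_inf \<mu>_inf"
    and "CMon_direct_limit TYPE(('w,'f) Mbar_elt monoid) I r
           (\<lambda>i. Mbar (E i)) (\<lambda>i j. Mbar_map (E j) (\<phi> i j)) M_inf \<mu>_inf"
  shows "\<exists>\<psi>. CMon_hom M_inf (Mbar E_inf) \<psi> \<and>
             bij_betw \<psi> (carrier M_inf) (carrier (Mbar E_inf)) \<and>
             (\<forall>i\<in>I. \<forall>x\<in>carrier (Mbar (E i)). \<psi> (\<mu>_inf i x) = Mbar_map E_inf (\<phi>_inf i) x)"
proof -
  interpret covered_cocone I r E \<phi> E_inf \<phi>_inf
  proof
    show "CKGr_cocone I r E \<phi> E_inf \<phi>_inf"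
      using assms(2) by (simp add: CKGr_direct_limit_def)
  qed (use assms(1) CKGr_direct_limit_covered[OF assms(1,2)] in simp_all)
  show ?thesis
    \<comment> \<open>\<open>CMon_direct_limit_Mbar\<close> is polymorphic in the type of the
      competing monoid and supplies the instances at the types of \<open>M_inf\<close> and of
      \<open>Mbar E_inf\<close>.\<close>
    by (rule CMon_direct_limit_unique[OF assms(3,4) CMon_direct_limit_Mbar CMon_direct_limit_Mbar])
qed

end
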